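(* Let $F=g+h$ on $\mathbb{R}^n$, where $g:\mathbb{R}^n\to\mathbb{R}\cup\{+\infty\}$ is proper and lower semicontinuous (possibly nonconvex and nonsmooth) and $h:\mathbb{R}^n\to\mathbb{R}$ is twice continuously differentiable with $L$-Lipschitz continuous gradient, $L\ge 0$. Suppose that (a) for every $\mathbf{x}\in\mathbb{R}^n$ and every $\mathcal{S}\subseteq\operatorname{supp}(\mathbf{x})$, the restricted Hessian $\nabla^2_{\mathcal{S}}F$ is strictly continuous at $\mathbf{x}$ relative to $\{\mathbf{z}:\operatorname{supp}(\mathbf{z})=\operatorname{supp}(\mathbf{x})\}$; (b) $\inf F>-\infty$; (c) $F$ is coercive, i.e. $F(\mathbf{x})\to+\infty$ as $\|\mathbf{x}\|\to+\infty$; (d) $F$ satisfies the Kurdyka--Łojasiewicz (KL) property at every point of $\operatorname{dom}(\partial F)$. Let $\{\mathbf{x}^k\}_{k\ge0}$ and $\{\mathbf{y}^k\}_{k\ge0}$ be generated by the SCN-PG algorithm (described in the context), with $\mathbf{x}^0=\mathbf{y}^0$, $0<\alpha<1/L$ and $\sigma_k\ge \frac{2(M(\mathbf{x}^k)+c)}{3}$. Then $$\sum_{k=1}^{\infty}\|\mathbf{x}^k-\mathbf{x}^{k-1}\|\le\sum_{k=1}^{\infty}\bigl(\|\mathbf{x}^k-\mathbf{y}^{k-1}\|+\|\mathbf{x}^{k-1}-\mathbf{y}^{k-1}\|\bigr)<\infty .$$ Consequently, $\{\mathbf{x}^k\}$ and $\{\mathbf{y}^k\}$ both converge to the same stationary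 point $\overline{\mathbf{x}}$, i.e. a point with $\mathbf{0}\in\partial g(\overline{\mathbf{x}})+\nabla h(\overline{\mathbf{x}})$.
   Context: Notation. $\operatorname{supp}(\mathbf{x})=\{i:x_i\ne0\}$. $\|\cdot\|$ is the Euclidean (or spectral) norm. $\partial$ is the limiting (Mordukhovich) subdifferential and $\operatorname{dom}(\partial F)=\{\mathbf x:\partial F(\mathbf x)\neq\emptyset\}$. For an index set $\mathcal S$, $\mathbf{x}_{\mathcal S}$ is the subvector indexed by $\mathcal S$, and $\nabla_{\mathcal S}F(\mathbf{x})$, $\nabla^2_{\mathcal S}F(\mathbf{x})$ are the gradient and Hessian of $F$ with respect to the variables indexed by $\mathcal S$ (the others being fixed). $\operatorname{Prox}_{\alpha g}(\mathbf{z})=\arg\min_{\mathbf{x}}\{g(\mathbf{x})+\frac1{2\alpha}\|\mathbf{x}-\mathbf{z}\|^2\}$. $1/L=+\infty$ if $L=0$. Strict continuity. A mapping $G$ is strictly continuous at $\overline{\mathbf{x}}$ relative to a set $X\ni\overline{\mathbf{x}}$ if $\operatorname{lip}_XG(\overline{\mathbf{x}}):=\limsup_{\mathbf{x},\mathbf{x}'\to\overline{\mathbf{x}},\ \mathbf{x}\neq\mathbf{x}'\in X}\frac{\|G(\mathbf{x}')-G(\mathbf{x})\|}{\|\mathbf{x}-\mathbf{x}'\|}$ is finite. Write $\operatorname{lip}\nabla^2_{\mathcal S}F(\mathbf{x})$ for the modulus relative to $X=\{\mathbf{z}:\operatorname{supp}(\mathbf{z})=\operatorname{supp}(\mathbf{x})\}$.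 KL property. $F$ has the KL property at $\widehat{\mathbf{x}}\in\operatorname{dom}\partial F$ if there are $\eta_0\in(0,+\infty]$, a neighborhood $U$ of $\widehat{\mathbf{x}}$ and a concave continuous $\phi:[0,\eta_0)\to[0,\infty)$ with $\phi(0)=0$, $\phi$ being $C^1$ on $(0,\eta_0)$ with $\phi'>0$ there, such that $\phi'(F(\mathbf{x})-F(\widehat{\mathbf{x}}))\operatorname{dist}(\mathbf{0},\partial F(\mathbf{x}))\ge1$ for all $\mathbf{x}\in U$ with $F(\widehat{\mathbf{x}})<F(\mathbf{x})<F(\widehat{\mathbf{x}})+\eta_0$. SCN-PG algorithm (run indefinitely). Inputs: $\mathbf{y}^0\in\mathbb{R}^n$, $0<\alpha<1/L$, $c>0$, $\eta>0$, $0<q<1$, $\omega_k\ge\underline\omega>1$, $\varepsilon_k>0$. For $k=1,2,\dots$: (1) $\mathbf{x}^k\in\operatorname{Prox}_{\alpha g}(\mathbf{y}^{k-1}-\alpha\nabla h(\mathbf{y}^{k-1}))$. (2) $\mathcal S^k=\{i:|x^k_i|\ge\varepsilon_k\}$, $n_k=|\mathcal S^k|$. (3) If $\mathcal S^k=\emptyset$, set $\mathbf{y}^k=\mathbf{x}^k$. Otherwise let $\mathbf{g}^k=\nabla_{\mathcal S^k}F(\mathbf{x}^k)$, $H^k=\nabla^2_{\mathcal S^k}F(\mathbf{x}^k)$, choose $M(\mathbf{x}^k)\ge\omega_k\operatorname{lip}\nabla^2_{\mathcal S^k}F(\mathbf{x}^k)$ and $\sigma_k\ge\frac{2(M(\mathbf{x}^k)+c)}3$,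 and let $\mathbf{d}^k$ be a global minimizer over $\mathbb{R}^{n_k}$ of $\langle\mathbf{g}^k,\mathbf{d}\rangle+\frac12\langle(H^k+\eta I)\mathbf{d},\mathbf{d}\rangle+\frac{\sigma_k}6\|\mathbf{d}\|^3$. For $j=0,1,2,\dots$ let $\mathbf{y}^{k,j}$ be given by $\mathbf{y}^{k,j}_{\mathcal S^k}=\mathbf{x}^k_{\mathcal S^k}+q^j\mathbf{d}^k$, $\mathbf{y}^{k,j}_{(\mathcal S^k)^c}=\mathbf{x}^k_{(\mathcal S^k)^c}$; take the first $j$ with $F(\mathbf{y}^{k,j})\le F(\mathbf{x}^k)-\frac\eta4\|\mathbf{y}^{k,j}-\mathbf{x}^k\|^2-\frac c6\|\mathbf{y}^{k,j}-\mathbf{x}^k\|^3$ and set $\mathbf{y}^k=\mathbf{y}^{k,j}$, $\beta_k=q^j$. The condition on $\sigma_k$ concerns those $k$ with $\mathcal S^k\ne\emptyset$. *)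

theory Defs
  imports "HOL-Analysis.Analysis"
begin

section \<open>Extended-real-valued functions and subdifferentials\<close>

definition proper_fun :: "('a \<Rightarrow> ereal) \<Rightarrow> bool" where
  "proper_fun f \<longleftrightarrow> (\<forall>x. f x \<noteq> -\<infinity>) \<and> (\<exists>x. f x \<noteq> \<infinity>)"

definition lsc_fun :: "('a::topological_space \<Rightarrow> ereal) \<Rightarrow> bool" where
  "lsc_fun f \<longleftrightarrow> (\<forall>x. f x \<le> Liminf (at x) f)"

definition frechet_subdiff :: "('a::real_inner \<Rightarrow> ereal) \<Rightarrow> 'a \<Rightarrow> 'a set" where
  "frechet_subdiff f x =
     {v. \<bar>f x\<bar> \<noteq> \<infinity> \<and>
         0 \<le> Liminf (at x) (\<lambda>y. (f y - f x - ereal (v \<bullet> (y - x))) / ereal (norm (y - x)))}"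

definition limiting_subdiff :: "('a::real_inner \<Rightarrow> ereal) \<Rightarrow> 'a \<Rightarrow> 'a set" where
  "limiting_subdiff f x =
     {v. \<bar>f x\<bar> \<noteq> \<infinity> \<and>
         (\<exists>u w. u \<longlonglongrightarrow> x \<and> (\<lambda>k. f (u k)) \<longlonglongrightarrow> f x \<and>
                (\<forall>k. w k \<in> frechet_subdiff f (u k)) \<and> w \<longlonglongrightarrow> v)}"

definition dom_subdiff :: "('a::real_inner \<Rightarrow> ereal) \<Rightarrow> 'a set" where
  "dom_subdiff f = {x. limiting_subdiff f x \<noteq> {}}"

definition prox :: "real \<Rightarrow> ('a::real_inner \<Rightarrow> ereal) \<Rightarrow> 'a \<Rightarrow> 'a set" where
  "prox \<alpha> g z =
     {x. is_arg_min (\<lambda>u. g u + ereal (1 / (2 * \<alpha>) * (norm (u - z))\<^sup>2)) (\<lambda>_. True) x}"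

text \<open>Unlike \<^const>\<open>infdist\<close>, this distance to the empty set is \<open>\<infinity>\<close>.\<close>

definition dist_to_set :: "'a::metric_space \<Rightarrow> 'a set \<Rightarrow> ereal" where
  "dist_to_set a A = (INF v\<in>A. ereal (dist a v))"

definition KL_property :: "('a::real_inner \<Rightarrow> ereal) \<Rightarrow> 'a \<Rightarrow> bool" where
  "KL_property F xh \<longleftrightarrow>
     xh \<in> dom_subdiff F \<and>
     (\<exists>(\<eta>0::ereal) U (\<phi>::real \<Rightarrow> real) \<phi>'.
        0 < \<eta>0 \<and> open U \<and> xh \<in> U \<and>
        concave_on {t. 0 \<le> t \<and> ereal t < \<eta>0} \<phi> \<and>
        continuous_on {t. 0 \<le> t \<and> ereal t < \<eta>0} \<phi> \<and>
        (\<forall>t. 0 \<le> t \<and> ereal t < \<eta>0 \<longrightarrow> 0 \<le> \<phi> t) \<and>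
        \<phi> 0 = 0 \<and>
        (\<forall>t. 0 < t \<and> ereal t < \<eta>0 \<longrightarrow> (\<phi> has_real_derivative \<phi>' t) (at t) \<and> 0 < \<phi>' t) \<and>
        continuous_on {t. 0 < t \<and> ereal t < \<eta>0} \<phi>' \<and>
        (\<forall>x\<in>U. F xh < F x \<and> F x < F xh + \<eta>0 \<longrightarrow>
           1 \<le> ereal (\<phi>' (real_of_ereal (F x - F xh))) * dist_to_set 0 (limiting_subdiff F x)))"

section \<open>Gradients and Hessians\<close>

definition gradient :: "('a::real_inner \<Rightarrow> real) \<Rightarrow> 'a \<Rightarrow> 'a" where
  "gradient f x = (THE v. GDERIV f x :> v)"

text \<open>As a bounded linear map, the Hessian is measured in the operator (spectral) norm; the norm
  of \<^typ>\<open>real^'n^'n\<close> would be the Frobenius norm.\<close>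

definition hessian :: "('a::real_inner \<Rightarrow> real) \<Rightarrow> 'a \<Rightarrow> 'a \<Rightarrow>\<^sub>L 'a" where
  "hessian f x = (THE H. (gradient f has_derivative blinfun_apply H) (at x))"

definition twice_differentiable_at :: "('a::real_inner \<Rightarrow> real) \<Rightarrow> 'a \<Rightarrow> bool" where
  "twice_differentiable_at f x \<longleftrightarrow>
     (\<forall>\<^sub>F z in nhds x. \<exists>v. GDERIV f z :> v) \<and> gradient f differentiable (at x)"

definition twice_continuously_differentiable :: "('a::real_inner \<Rightarrow> real) \<Rightarrow> bool" where
  "twice_continuously_differentiable f \<longleftrightarrow>
     (\<forall>x. twice_differentiable_at f x) \<and> continuous_on UNIV (hessian f)"

lemma gradient_eqI:
  assumes "GDERIV f x :> v"
  shows "gradient f x = v"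
  unfolding gradient_def
proof (rule the_equality)
  fix w assume "GDERIV f x :> w"
  with assms have "(\<lambda>h. h \<bullet> w) = (\<lambda>h. h \<bullet> v)"
    unfolding gderiv_def by (rule has_derivative_unique[rotated])
  then have "(w - v) \<bullet> w = (w - v) \<bullet> v" by (rule fun_cong)
  then have "(w - v) \<bullet> (w - v) = 0" by (simp add: inner_diff_right)
  then show "w = v" by simp
qed (rule assms)

lemma hessian_eqI:
  assumes "(gradient f has_derivative blinfun_apply H) (at x)"
  shows "hessian f x = H"
  unfolding hessian_def
proof (rule the_equality)
  fix K assume "(gradient f has_derivative blinfun_apply K) (at x)"
  with assms have "blinfun_apply K = blinfun_apply H"
    by (rule has_derivative_unique[rotated])
  then show "K = H" by (simp add: blinfun_apply_inject)
qed (rule assms)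

section \<open>Restriction to a set of coordinates\<close>

text \<open>A vector indexed by a coordinate set \<open>S\<close> is represented by its extension by zero to all
  coordinates, so that inner products, norms and operator norms agree.\<close>

definition supp :: "real^'n \<Rightarrow> 'n set" where
  "supp x = {i. x $ i \<noteq> 0}"

definition replace_coords :: "'n set \<Rightarrow> real^'n \<Rightarrow> real^'n \<Rightarrow> real^'n" where
  "replace_coords S x z = (\<chi> i. if i \<in> S then z $ i else x $ i)"

definition section_fun :: "'n::finite set \<Rightarrow> (real^'n \<Rightarrow> ereal) \<Rightarrow> real^'n \<Rightarrow> real^'n \<Rightarrow> real" where
  "section_fun S F x z = real_of_ereal (F (replace_coords S x z))"

text \<open>The section does not depend on the coordinates outside \<open>S\<close>, so its gradient vanishes outside
  \<open>S\<close> and its Hessian is the block on \<open>S\<close> padded with zeros.\<close>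

definition gradient_wrt :: "'n::finite set \<Rightarrow> (real^'n \<Rightarrow> ereal) \<Rightarrow> real^'n \<Rightarrow> real^'n" where
  "gradient_wrt S F x = gradient (section_fun S F x) x"

definition hessian_wrt ::
    "'n::finite set \<Rightarrow> (real^'n \<Rightarrow> ereal) \<Rightarrow> real^'n \<Rightarrow> (real^'n) \<Rightarrow>\<^sub>L (real^'n)" where
  "hessian_wrt S F x = hessian (section_fun S F x) x"

text \<open>Having a Hessian includes finiteness of \<open>F\<close> near \<open>x\<close> along the variables in \<open>S\<close>; for empty
  \<open>S\<close> there are no variables and no condition is imposed.\<close>

definition has_hessian_wrt :: "'n::finite set \<Rightarrow> (real^'n \<Rightarrow> ereal) \<Rightarrow> real^'n \<Rightarrow> bool" where
  "has_hessian_wrt S F x \<longleftrightarrow>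
     S = {} \<or>
     ((\<forall>\<^sub>F z in nhds x. \<bar>F (replace_coords S x z)\<bar> \<noteq> \<infinity>) \<and>
      twice_differentiable_at (section_fun S F x) x)"

lemma GDERIV_section_fun_zero:
  assumes "GDERIV (section_fun S F x) z :> v" "i \<notin> S"
  shows "v $ i = 0"
proof -
  have "replace_coords S x (z + t *\<^sub>R axis i 1) = replace_coords S x z" for t
    using assms(2) by (auto simp: replace_coords_def vec_eq_iff axis_def)
  then have const: "section_fun S F x (z + t *\<^sub>R axis i 1) = section_fun S F x z" for t
    by (simp add: section_fun_def)
  have "(section_fun S F x has_derivative (\<lambda>h. h \<bullet> v)) (at (z + 0 *\<^sub>R axis i 1))"
    using assms(1) by (simp add: gderiv_def)
  moreover have "((\<lambda>t::real. z + t *\<^sub>R axis i 1) has_derivative (\<lambda>t. t *\<^sub>R axis i 1)) (at 0)"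
    by (auto intro!: derivative_eq_intros)
  ultimately have "((\<lambda>t::real. section_fun S F x (z + t *\<^sub>R axis i 1)) has_derivative
      (\<lambda>t. (t *\<^sub>R axis i 1) \<bullet> v)) (at 0)"
    by (rule has_derivative_compose[rotated])
  then have "((\<lambda>t::real. section_fun S F x z) has_derivative (\<lambda>t. (t *\<^sub>R axis i 1) \<bullet> v)) (at 0)"
    by (simp add: const)
  then have "(\<lambda>t::real. (t *\<^sub>R axis i 1) \<bullet> v) = (\<lambda>t. 0)"
    by (rule has_derivative_unique) simp
  then have "(1 *\<^sub>R axis i 1) \<bullet> v = 0" by (rule fun_cong)
  then show ?thesis by (simp add: inner_axis')
qed

section \<open>Strict continuity\<close>

text \<open>At an isolated point of \<open>X\<close> the filter is trivial and the modulus is \<open>-\<infinity>\<close>, so strict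
  continuity holds there.\<close>

definition lip_modulus ::
    "'a::real_normed_vector set \<Rightarrow> ('a \<Rightarrow> 'b::real_normed_vector) \<Rightarrow> 'a \<Rightarrow> ereal" where
  "lip_modulus X G xb =
     Limsup (at (xb, xb) within {(x, x'). x \<in> X \<and> x' \<in> X \<and> x \<noteq> x'})
       (\<lambda>(x, x'). ereal (norm (G x' - G x) / norm (x - x')))"

definition strictly_continuous_at_rel ::
    "'a::real_normed_vector set \<Rightarrow> ('a \<Rightarrow> 'b::real_normed_vector) \<Rightarrow> 'a \<Rightarrow> bool" where
  "strictly_continuous_at_rel X G xb \<longleftrightarrow> xb \<in> X \<and> lip_modulus X G xb < \<infinity>"

section \<open>The algorithm\<close>

definition cubic_model ::
    "real^'n \<Rightarrow> ((real^'n) \<Rightarrow>\<^sub>L (real^'n)) \<Rightarrow> real \<Rightarrow> real \<Rightarrow> real^'n \<Rightarrow> real" where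
  "cubic_model v H \<eta> \<sigma> d =
     v \<bullet> d + 1 / 2 * ((blinfun_apply H d + \<eta> *\<^sub>R d) \<bullet> d) + \<sigma> / 6 * norm d ^ 3"

definition sufficient_decrease ::
    "(real^'n \<Rightarrow> ereal) \<Rightarrow> real \<Rightarrow> real \<Rightarrow> real^'n \<Rightarrow> real^'n \<Rightarrow> bool" where
  "sufficient_decrease F c \<eta> x y \<longleftrightarrow>
     F y \<le> F x - ereal (\<eta> / 4 * (norm (y - x))\<^sup>2) - ereal (c / 6 * norm (y - x) ^ 3)"

definition cubic_newton_step ::
    "(real^'n::finite \<Rightarrow> ereal) \<Rightarrow> real \<Rightarrow> real \<Rightarrow> real \<Rightarrow> real \<Rightarrow> real \<Rightarrow> real \<Rightarrow> real
      \<Rightarrow> real^'n \<Rightarrow> real^'n \<Rightarrow> bool" where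
  "cubic_newton_step F c \<eta> q \<omega> \<epsilon> M \<sigma> x y \<longleftrightarrow>
     (let S = {i. \<epsilon> \<le> \<bar>x $ i\<bar>} in
      if S = {} then y = x
      else
        ereal \<omega> * lip_modulus {z. supp z = supp x} (hessian_wrt S F) x \<le> ereal M \<and>
        2 * (M + c) / 3 \<le> \<sigma> \<and>
        (\<exists>d j. is_arg_min (cubic_model (gradient_wrt S F x) (hessian_wrt S F x) \<eta> \<sigma>)
                 (\<lambda>d. supp d \<subseteq> S) d \<and>
               sufficient_decrease F c \<eta> x (x + q ^ j *\<^sub>R d) \<and>
               (\<forall>i<j. \<not> sufficient_decrease F c \<eta> x (x + q ^ i *\<^sub>R d)) \<and>
               y = x + q ^ j *\<^sub>R d))"

definition SCN_PG ::
    "(real^'n::finite \<Rightarrow> ereal) \<Rightarrow> (real^'n \<Rightarrow> real) \<Rightarrow> real \<Rightarrow> real \<Rightarrow> real \<Rightarrow> real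
      \<Rightarrow> (nat \<Rightarrow> real) \<Rightarrow> (nat \<Rightarrow> real) \<Rightarrow> (nat \<Rightarrow> real) \<Rightarrow> (nat \<Rightarrow> real)
      \<Rightarrow> (nat \<Rightarrow> real^'n) \<Rightarrow> (nat \<Rightarrow> real^'n) \<Rightarrow> bool" where
  "SCN_PG g h \<alpha> c \<eta> q \<omega> \<epsilon> M \<sigma> x y \<longleftrightarrow>
     (\<forall>k\<ge>1.
        x k \<in> prox \<alpha> g (y (k - 1) - \<alpha> *\<^sub>R gradient h (y (k - 1))) \<and>
        cubic_newton_step (\<lambda>u. g u + ereal (h u)) c \<eta> q (\<omega> k) (\<epsilon> k) (M k) (\<sigma> k) (x k) (y k))"

end

theory Submission
  imports Defs
begin

text \<open>The cubic Newton step enters only through its sufficient decrease. The gap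
  \<open>t k = norm (x (k + 1) - y k) + norm (x k - y k)\<close> controls the decrease \<open>F (x k) - F (x (k + 1))\<close>
  from below by a multiple of \<open>(t k)\<^sup>2\<close>, while the prox step gives a subgradient of \<open>F\<close> at
  \<open>x (k + 1)\<close> of norm at most a multiple of \<open>t k\<close>. With the KL inequality at a cluster point
  this yields \<open>2 t (k + 1) + C \<phi> (k + 1) \<le> t k + C \<phi> k\<close>, where \<open>\<phi> k\<close> is the desingularized
  objective gap, as long as the iterates stay near the cluster point; telescoping keeps them there
  and makes \<open>t\<close> summable.\<close>

section \<open>Smooth functions and subgradients\<close>

lemma twice_continuously_differentiable_GDERIV:
  assumes "twice_continuously_differentiable h"
  shows "GDERIV h u :> gradient h u"
proof -
  have "\<forall>\<^sub>F z in nhds u. \<exists>v. GDERIV h z :> v"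
    using assms by (simp add: twice_continuously_differentiable_def twice_differentiable_at_def)
  then obtain v where "GDERIV h u :> v"
    using eventually_nhds_x_imp_x by blast
  then show ?thesis
    using gradient_eqI by metis
qed

text \<open>Along the segment from \<open>u\<close> to \<open>v\<close>, subtract from
  \<open>h\<close> its linearization at \<open>u\<close> and the quadratic term. Cauchy-Schwarz and
  the Lipschitz bound make the derivative of the remainder \<open>p\<close> nonpositive on [0,1];
  the claim is \<open>p 1 \<le> p 0\<close>.\<close>

lemma descent_lemma:
  fixes h :: "'a::real_inner \<Rightarrow> real"
  assumes deriv: "\<And>u. GDERIV h u :> G u" and lip: "L-lipschitz_on UNIV G"
  shows "h v \<le> h u + G u \<bullet> (v - u) + L / 2 * (norm (v - u))\<^sup>2"
proof -
  define d where "d = v - u"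
  define p where "p t = h (u + t *\<^sub>R d) - t * (G u \<bullet> d) - L / 2 * t\<^sup>2 * (norm d)\<^sup>2" for t
  have p_deriv: "(p has_real_derivative
      (G (u + t *\<^sub>R d) \<bullet> d - G u \<bullet> d - L * t * (norm d)\<^sup>2)) (at t)" for t
  proof -
    have "((\<lambda>t. u + t *\<^sub>R d) has_derivative (\<lambda>s. s *\<^sub>R d)) (at t)"
      by (auto intro!: derivative_eq_intros)
    moreover have "(h has_derivative (\<lambda>k. k \<bullet> G (u + t *\<^sub>R d))) (at (u + t *\<^sub>R d))"
      using deriv by (simp add: gderiv_def)
    ultimately have "((\<lambda>t. h (u + t *\<^sub>R d)) has_derivative
        (\<lambda>s. (s *\<^sub>R d) \<bullet> G (u + t *\<^sub>R d))) (at t)"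
      by (rule has_derivative_compose)
    then have *: "((\<lambda>t. h (u + t *\<^sub>R d)) has_real_derivative G (u + t *\<^sub>R d) \<bullet> d) (at t)"
      by (simp add: has_field_derivative_def inner_commute mult_commute_abs)
    show ?thesis
      unfolding p_def
      by (rule derivative_eq_intros * refl | simp)+
  qed
  have "p 1 \<le> p 0"
  proof (rule DERIV_nonpos_imp_nonincreasing[of 0 1 p])
    fix t :: real assume t: "0 \<le> t" "t \<le> 1"
    have "(G (u + t *\<^sub>R d) - G u) \<bullet> d \<le> norm (G (u + t *\<^sub>R d) - G u) * norm d"
      by (rule norm_cauchy_schwarz)
    also have "\<dots> \<le> (L * norm (t *\<^sub>R d)) * norm d"
      using lipschitz_onD[OF lip, of "u + t *\<^sub>R d" u]
      by (intro mult_right_mono) (auto simp: dist_norm)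
    also have "\<dots> = L * t * (norm d)\<^sup>2"
      using t by (simp add: power2_eq_square)
    finally show "\<exists>z. (p has_real_derivative z) (at t) \<and> z \<le> 0"
      using p_deriv[of t] by (auto simp: inner_diff_left)
  qed simp
  then show ?thesis
    by (simp add: p_def d_def)
qed

text \<open>The descent lemma for \<open>- h\<close>. It supplies the quadratic minorant of
  \<open>h\<close> that turns a subgradient of \<open>g\<close> into one of
  \<open>g + h\<close>.\<close>

lemma descent_lemma_lower:
  fixes h :: "'a::real_inner \<Rightarrow> real"
  assumes deriv: "\<And>u. GDERIV h u :> G u" and lip: "L-lipschitz_on UNIV G"
  shows "h u + G u \<bullet> (v - u) - L / 2 * (norm (v - u))\<^sup>2 \<le> h v"
proof -
  have "GDERIV (\<lambda>u. - h u) u :> - G u" for u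
    using deriv by (rule GDERIV_minus)
  moreover have "L-lipschitz_on UNIV (\<lambda>u. - G u)"
    using lip by simp
  ultimately show ?thesis
    using descent_lemma[of "\<lambda>u. - h u" "\<lambda>u. - G u" L v u] by simp
qed

text \<open>Dividing the quadratic error by \<open>norm (u - x)\<close> leaves a term of first
  order, which vanishes as u tends to x. All subgradients below are obtained from such
  minorants.\<close>

lemma frechet_subdiffI_quadratic:
  fixes f :: "'a::real_inner \<Rightarrow> ereal"
  assumes fin: "f x = ereal r"
    and minor: "\<And>u. ereal (r + v \<bullet> (u - x) - C * (norm (u - x))\<^sup>2) \<le> f u"
  shows "v \<in> frechet_subdiff f x"
proof -
  let ?Q = "\<lambda>u. (f u - f x - ereal (v \<bullet> (u - x))) / ereal (norm (u - x))"
  have Q: "ereal (- C * norm (u - x)) \<le> ?Q u" if "u \<noteq> x" for u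
  proof (cases "f u")
    case (real s)
    have "(- C * norm (u - x)) * norm (u - x) \<le> s - r - v \<bullet> (u - x)"
      using minor[of u] real by (simp add: power2_eq_square)
    then have "- C * norm (u - x) \<le> (s - r - v \<bullet> (u - x)) / norm (u - x)"
      using that by (subst pos_le_divide_eq) auto
    then show ?thesis
      using real fin that by simp
  next
    case PInf
    then show ?thesis using fin that by simp
  next
    case MInf
    then show ?thesis using minor[of u] by simp
  qed
  have "((\<lambda>u. - C * norm (u - x)) \<longlongrightarrow> - C * norm (x - x)) (at x)"
    by (intro tendsto_intros)
  then have lim: "((\<lambda>u. ereal (- C * norm (u - x))) \<longlongrightarrow> 0) (at x)"
    by (simp add: zero_ereal_def)
  have "\<forall>\<^sub>F u in at x. c < ?Q u" if "c < 0" for c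
  proof -
    have "\<forall>\<^sub>F u in at x. c < ereal (- C * norm (u - x))"
      using lim that by (rule order_tendstoD)
    moreover have "\<forall>\<^sub>F u in at x. u \<noteq> x"
      by (simp add: eventually_at_filter)
    ultimately show ?thesis
      by eventually_elim (use Q in \<open>auto intro: less_le_trans\<close>)
  qed
  then show ?thesis
    by (simp add: frechet_subdiff_def fin le_Liminf_iff)
qed

lemma limiting_subdiffI:
  assumes "\<bar>f x\<bar> \<noteq> \<infinity>" "u \<longlonglongrightarrow> x" "(\<lambda>k. f (u k)) \<longlonglongrightarrow> f x"
    and "\<And>k. w k \<in> frechet_subdiff f (u k)" "w \<longlonglongrightarrow> v"
  shows "v \<in> limiting_subdiff f x"
  using assms unfolding limiting_subdiff_def by blast

lemma frechet_subdiff_subset_limiting: "frechet_subdiff f x \<subseteq> limiting_subdiff f x"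
proof
  fix v assume v: "v \<in> frechet_subdiff f x"
  show "v \<in> limiting_subdiff f x"
    by (rule limiting_subdiffI[where u = "\<lambda>_. x" and w = "\<lambda>_. v"])
      (use v in \<open>auto simp: frechet_subdiff_def\<close>)
qed

lemma lsc_fun_eventually_less:
  assumes "lsc_fun f" "z \<longlonglongrightarrow> x" "c < f x"
  shows "\<forall>\<^sub>F k in sequentially. c < f (z k)"
proof -
  have "c < Liminf (at x) f"
    using assms(1,3) by (auto simp: lsc_fun_def intro: less_le_trans)
  then have "\<forall>\<^sub>F u in at x. c < f u"
    by (rule less_LiminfD)
  \<comment> \<open>The sequence may hit \<open>x\<close> itself, which the punctured filter misses;
    \<open>c < f x\<close> covers that point.\<close>
  then have "\<forall>\<^sub>F u in nhds x. c < f u"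
    unfolding eventually_at_filter by (rule eventually_mono) (use assms(3) in auto)
  with assms(2) show ?thesis
    unfolding filterlim_iff by blast
qed

section \<open>The prox step\<close>

lemma prox_finite:
  assumes "proper_fun g" "x \<in> prox \<alpha> g z"
  shows "\<bar>g x\<bar> \<noteq> \<infinity>"
proof -
  obtain u where u: "g u \<noteq> \<infinity>" and "g x \<noteq> -\<infinity>"
    using assms(1) by (auto simp: proper_fun_def)
  have "g x + ereal (1 / (2 * \<alpha>) * (norm (x - z))\<^sup>2) \<le> g u + ereal (1 / (2 * \<alpha>) * (norm (u - z))\<^sup>2)"
    using assms(2) by (auto simp: prox_def is_arg_min_def not_less)
  with u have "g x \<noteq> \<infinity>"
    by (cases "g u") auto
  with \<open>g x \<noteq> -\<infinity>\<close> show ?thesis by auto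
qed

text \<open>Minimality with both penalties on one side. It is used at the previous point
  \<open>y\<close> for the decrease and at the cluster point for the value of
  \<open>g\<close>.\<close>

lemma prox_minorant:
  assumes "x \<in> prox \<alpha> g z" "g x = ereal r"
  shows "ereal (r + 1 / (2 * \<alpha>) * ((norm (x - z))\<^sup>2 - (norm (u - z))\<^sup>2)) \<le> g u"
proof -
  have "g x + ereal (1 / (2 * \<alpha>) * (norm (x - z))\<^sup>2) \<le> g u + ereal (1 / (2 * \<alpha>) * (norm (u - z))\<^sup>2)"
    using assms(1) by (auto simp: prox_def is_arg_min_def not_less)
  then show ?thesis
    using assms(2) by (cases "g u") (auto simp: algebra_simps)
qed

text \<open>Expanding \<open>norm (u - z)\<close> squared around \<open>x\<close> turns the
  difference of penalties into a linear term, whose slope is the subgradient, and a quadratic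
  error.\<close>

lemma prox_minorant_subgradient:
  fixes x z :: "'a::real_inner"
  assumes "x \<in> prox \<alpha> g z" "g x = ereal r"
  shows "ereal (r + (1 / \<alpha>) *\<^sub>R (z - x) \<bullet> (u - x) - 1 / (2 * \<alpha>) * (norm (u - x))\<^sup>2) \<le> g u"
proof -
  have "(norm (x - z))\<^sup>2 - (norm (u - z))\<^sup>2 = 2 * ((z - x) \<bullet> (u - x)) - (norm (u - x))\<^sup>2"
    unfolding power2_norm_eq_inner
    by (simp add: inner_diff_left inner_diff_right inner_commute algebra_simps)
  then have "r + 1 / (2 * \<alpha>) * ((norm (x - z))\<^sup>2 - (norm (u - z))\<^sup>2)
      = r + (1 / \<alpha>) *\<^sub>R (z - x) \<bullet> (u - x) - 1 / (2 * \<alpha>) * (norm (u - x))\<^sup>2"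
    by (simp only: inner_scaleR_left right_diff_distrib)
  then show ?thesis
    using prox_minorant[OF assms, of u] by (simp add: add_diff_eq)
qed

lemma prox_in_frechet_subdiff:
  assumes "x \<in> prox \<alpha> g z" "g x = ereal r"
  shows "(1 / \<alpha>) *\<^sub>R (z - x) \<in> frechet_subdiff g x"
  using assms(2) prox_minorant_subgradient[OF assms] by (rule frechet_subdiffI_quadratic)

text \<open>The minorant of \<open>g\<close> from the prox step and the minorant of \<open>h\<close>
  from its Lipschitz gradient add up to a quadratic minorant of the sum.\<close>

lemma prox_in_frechet_subdiff_add:
  fixes x z :: "'a::real_inner"
  assumes x: "x \<in> prox \<alpha> g z" "g x = ereal r"
    and deriv: "\<And>u. GDERIV h u :> G u" and lip: "L-lipschitz_on UNIV G"
  shows "(1 / \<alpha>) *\<^sub>R (z - x) + G x \<in> frechet_subdiff (\<lambda>u. g u + ereal (h u)) x"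
proof (rule frechet_subdiffI_quadratic)
  show "g x + ereal (h x) = ereal (r + h x)"
    using x by simp
  fix u
  let ?v = "(1 / \<alpha>) *\<^sub>R (z - x)"
  have "ereal (r + ?v \<bullet> (u - x) - 1 / (2 * \<alpha>) * (norm (u - x))\<^sup>2) \<le> g u"
    by (rule prox_minorant_subgradient[OF x])
  moreover have "h x + G x \<bullet> (u - x) - L / 2 * (norm (u - x))\<^sup>2 \<le> h u"
    by (rule descent_lemma_lower[OF deriv lip])
  ultimately have "ereal (r + ?v \<bullet> (u - x) - 1 / (2 * \<alpha>) * (norm (u - x))\<^sup>2)
      + ereal (h x + G x \<bullet> (u - x) - L / 2 * (norm (u - x))\<^sup>2) \<le> g u + ereal (h u)"
    by (intro add_mono) auto
  moreover have "r + ?v \<bullet> (u - x) - 1 / (2 * \<alpha>) * (norm (u - x))\<^sup>2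
      + (h x + G x \<bullet> (u - x) - L / 2 * (norm (u - x))\<^sup>2)
      = r + h x + (?v + G x) \<bullet> (u - x) - (1 / (2 * \<alpha>) + L / 2) * (norm (u - x))\<^sup>2"
    unfolding inner_add_left distrib_right by linarith
  ultimately show "ereal (r + h x + (?v + G x) \<bullet> (u - x)
      - (1 / (2 * \<alpha>) + L / 2) * (norm (u - x))\<^sup>2) \<le> g u + ereal (h u)"
    by (simp only: plus_ereal.simps)
qed

text \<open>Comparing \<open>x\<close> with the competitor \<open>y\<close> yields the term
  \<open>G y \<bullet> (x - y)\<close>, which cancels against the linear term of the descent lemma
  at \<open>y\<close>. The remaining factor is positive when
  \<open>\<alpha> * L < 1\<close>.\<close>

lemma prox_gradient_decrease:
  fixes x y :: "'a::real_inner"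
  assumes x: "x \<in> prox \<alpha> g (y - \<alpha> *\<^sub>R G y)" "g x = ereal r" and \<alpha>: "\<alpha> \<noteq> 0"
    and deriv: "\<And>u. GDERIV h u :> G u" and lip: "L-lipschitz_on UNIV G"
  shows "ereal (r + h x + (1 / (2 * \<alpha>) - L / 2) * (norm (x - y))\<^sup>2) \<le> g y + ereal (h y)"
proof -
  have *: "(norm (x - (y - \<alpha> *\<^sub>R G y)))\<^sup>2 - (norm (y - (y - \<alpha> *\<^sub>R G y)))\<^sup>2
      = (norm (x - y))\<^sup>2 + 2 * \<alpha> * (G y \<bullet> (x - y))"
    unfolding power2_norm_eq_inner
    by (simp add: inner_diff_left inner_diff_right inner_commute algebra_simps)
  have "1 / (2 * \<alpha>) * ((norm (x - y))\<^sup>2 + 2 * \<alpha> * (G y \<bullet> (x - y)))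
      = 1 / (2 * \<alpha>) * (norm (x - y))\<^sup>2 + G y \<bullet> (x - y)"
    using \<alpha> by (simp add: field_simps)
  then have "ereal (r + (1 / (2 * \<alpha>) * (norm (x - y))\<^sup>2 + G y \<bullet> (x - y))) \<le> g y"
    using prox_minorant[OF x, of y] unfolding * by simp
  moreover have "h x - G y \<bullet> (x - y) - L / 2 * (norm (x - y))\<^sup>2 \<le> h y"
    using descent_lemma[OF deriv lip, of x y] by simp
  ultimately have "ereal (r + (1 / (2 * \<alpha>) * (norm (x - y))\<^sup>2 + G y \<bullet> (x - y)))
      + ereal (h x - G y \<bullet> (x - y) - L / 2 * (norm (x - y))\<^sup>2) \<le> g y + ereal (h y)"
    by (intro add_mono) auto
  then show ?thesis
    by (simp add: algebra_simps)
qed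

section \<open>Finite length from the KL inequality\<close>

text \<open>This is the tangent inequality for the convex function \<open>- \<phi>\<close>. As s >
  0, \<open>s\<close> is interior to the domain, while \<open>t\<close> may be the endpoint 0. The
  bound \<open>\<eta>0\<close> is an \<open>ereal\<close> because the domain may be
  unbounded.\<close>

lemma concave_on_gradient_inequality:
  fixes \<phi> :: "real \<Rightarrow> real" and \<eta>0 :: ereal
  assumes conc: "concave_on {t. 0 \<le> t \<and> ereal t < \<eta>0} \<phi>"
    and deriv: "(\<phi> has_real_derivative D) (at s)"
    and s: "0 < s" "ereal s < \<eta>0" and t: "0 \<le> t" "ereal t < \<eta>0"
  shows "D * (s - t) \<le> \<phi> s - \<phi> t"
proof -
  let ?A = "{t. 0 \<le> t \<and> ereal t < \<eta>0}"
  have conv: "convex_on ?A (\<lambda>t. - \<phi> t)"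
    using conc unfolding concave_on_def .
  have con: "connected ?A"
    using convex_on_imp_convex[OF conv] by (rule convex_connected)
  have op: "open {t. ereal t < \<eta>0}"
    by (intro open_Collect_less continuous_on_ereal continuous_on_id continuous_on_const)
  have int: "s \<in> interior ?A"
    by (rule interiorI[OF open_Int[OF open_greaterThan[of 0] op]]) (use s in auto)
  have "((\<lambda>t. - \<phi> t) has_real_derivative - D) (at s within ?A)"
    by (rule has_field_derivative_at_within[OF DERIV_minus[OF deriv]])
  moreover have "t \<in> ?A"
    using t by simp
  ultimately have "- D * (t - s) \<le> - \<phi> t - - \<phi> s"
    by (intro convex_on_imp_above_tangent[OF conv con int])
  then show ?thesis
    by (simp add: algebra_simps)
qed

text \<open>Index convention: \<open>t k\<close> bounds the subgradient at \<open>X k\<close>, while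
  \<open>t (Suc k)\<close> controls the decrease and the move away from \<open>X k\<close>. One
  index near \<open>xb\<close>, taken from the subsequence, suffices to trap all later
  points.\<close>

lemma KL_finite_length:
  fixes X :: "nat \<Rightarrow> 'a::real_inner" and f t :: "nat \<Rightarrow> real"
  assumes KL: "KL_property F xb" and Fxb: "F xb = ereal fs"
    and FX: "\<And>k. F (X k) = ereal (f k)" and f_lim: "f \<longlonglongrightarrow> fs"
    and mb: "m > 0" "b > 0" and t0: "\<And>k. 0 \<le> t k" and t_lim: "t \<longlonglongrightarrow> 0"
    and dec: "\<And>k. m * (t (Suc k))\<^sup>2 \<le> f k - f (Suc k)"
    and step: "\<And>k. norm (X (Suc k) - X k) \<le> t (Suc k)"
    and sub: "\<And>k. w k \<in> limiting_subdiff F (X k)" "\<And>k. norm (w k) \<le> b * t k"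
    and r: "strict_mono r" "(X \<circ> r) \<longlonglongrightarrow> xb"
  shows "summable t"
proof (cases "\<exists>k. f k \<le> fs")
  \<comment> \<open>The KL inequality is silent at the level \<open>fs\<close>. Once
    \<open>f\<close> reaches its limit it stays constant, so every later decrease, and with it
    \<open>t\<close>, is zero.\<close>
  case True
  then obtain k where k: "f k \<le> fs" ..
  have anti: "decseq f"
    using dec mb by (intro decseq_SucI) (smt (verit) zero_le_power2 mult_nonneg_nonneg)
  have "t (Suc i) = 0" if "i \<ge> k" for i
  proof -
    have "f i \<le> fs" "fs \<le> f (Suc i)"
      using decseqD[OF anti that] k decseq_ge[OF anti f_lim] by auto
    with dec[of i] have "m * (t (Suc i))\<^sup>2 \<le> 0" by simp
    with mb show ?thesis by (simp add: mult_le_0_iff)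
  qed
  then have "t i = 0" if "i \<notin> {..k}" for i
    using that by (cases i) auto
  then show ?thesis
    by (intro summable_finite[of "{..k}"]) auto
next
  case False
  then have f_gt: "fs < f k" for k by (simp add: not_le)
  from KL obtain \<eta>0 :: ereal and U and \<phi> \<phi>' :: "real \<Rightarrow> real" where
    \<eta>0: "0 < \<eta>0" and U: "open U" "xb \<in> U"
    and conc: "concave_on {t. 0 \<le> t \<and> ereal t < \<eta>0} \<phi>"
    and cont: "continuous_on {t. 0 \<le> t \<and> ereal t < \<eta>0} \<phi>"
    and nonneg: "\<forall>t. 0 \<le> t \<and> ereal t < \<eta>0 \<longrightarrow> 0 \<le> \<phi> t" and \<phi>0: "\<phi> 0 = 0"
    and deriv: "\<forall>t. 0 < t \<and> ereal t < \<eta>0 \<longrightarrow> (\<phi> has_real_derivative \<phi>' t) (at t) \<and> 0 < \<phi>' t"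
    and ineq: "\<forall>x\<in>U. F xb < F x \<and> F x < F xb + \<eta>0 \<longrightarrow>
           1 \<le> ereal (\<phi>' (real_of_ereal (F x - F xb))) * dist_to_set 0 (limiting_subdiff F x)"
    unfolding KL_property_def by blast
  \<comment> \<open>The ratio of the subgradient constant to the decrease constant appears when the
    two bounds are multiplied below.\<close>
  define C where "C = b / m"
  define \<psi> where "\<psi> k = \<phi> (f k - fs)" for k
  have C: "C > 0" using mb by (simp add: C_def)
  have anti: "decseq f"
    using dec mb by (intro decseq_SucI) (smt (verit) zero_le_power2 mult_nonneg_nonneg)
  obtain \<rho> where \<rho>: "\<rho> > 0" "ball xb \<rho> \<subseteq> U"
    using U openE by blast
  have gap_lim: "(\<lambda>k. f k - fs) \<longlonglongrightarrow> 0"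
    using f_lim by (simp add: LIM_zero)
  then have "(\<lambda>k. ereal (f k - fs)) \<longlonglongrightarrow> 0"
    by (simp add: zero_ereal_def)
  then have gap_ev: "\<forall>\<^sub>F k in sequentially. ereal (f k - fs) < \<eta>0"
    using \<eta>0 by (rule order_tendstoD)
  have "\<psi> \<longlonglongrightarrow> \<phi> 0"
    unfolding \<psi>_def
  proof (rule continuous_on_tendsto_compose[OF cont gap_lim])
    show "\<forall>\<^sub>F k in sequentially. f k - fs \<in> {t. 0 \<le> t \<and> ereal t < \<eta>0}"
      using gap_ev by eventually_elim (use f_gt in \<open>auto intro: less_imp_le\<close>)
  qed (use \<eta>0 in \<open>auto simp: zero_ereal_def\<close>)
  \<comment> \<open>This potential bounds the length of the remaining path. It tends to 0 by
    continuity of \<open>\<phi>\<close> at 0.\<close>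
  then have "(\<lambda>k. t k + C * \<psi> k) \<longlonglongrightarrow> 0 + C * \<phi> 0"
    by (intro tendsto_intros t_lim)
  then have "(\<lambda>k. t k + C * \<psi> k) \<longlonglongrightarrow> 0"
    by (simp add: \<phi>0)
  then have "\<forall>\<^sub>F k in sequentially. t k + C * \<psi> k < \<rho> / 2"
    by (rule order_tendstoD) (use \<rho> in simp)
  with gap_ev have "\<forall>\<^sub>F k in sequentially. ereal (f k - fs) < \<eta>0 \<and> t k + C * \<psi> k < \<rho> / 2"
    by eventually_elim simp
  then have "\<forall>\<^sub>F j in sequentially. ereal (f (r j) - fs) < \<eta>0 \<and> t (r j) + C * \<psi> (r j) < \<rho> / 2"
    by (rule eventually_subseq[OF r(1)])
  moreover have "\<forall>\<^sub>F j in sequentially. dist ((X \<circ> r) j) xb < \<rho> / 2"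
    using r(2) by (rule tendstoD) (use \<rho> in simp)
  ultimately have "\<forall>\<^sub>F j in sequentially. ereal (f (r j) - fs) < \<eta>0
      \<and> t (r j) + C * \<psi> (r j) < \<rho> / 2 \<and> dist (X (r j)) xb < \<rho> / 2"
    by eventually_elim simp
  \<comment> \<open>Half of the radius \<open>\<rho>\<close> is reserved for the distance of
    \<open>X K\<close> from \<open>xb\<close>, the other half for the path after
    \<open>K\<close>.\<close>
  then obtain K where K: "ereal (f K - fs) < \<eta>0" "t K + C * \<psi> K < \<rho> / 2" "dist (X K) xb < \<rho> / 2"
    using eventually_happens by fastforce
  have gap: "0 < f k - fs" "ereal (f k - fs) < \<eta>0" if "k \<ge> K" for k
  proof -
    show "0 < f k - fs" using f_gt[of k] by simp
    have "ereal (f k - fs) \<le> ereal (f K - fs)"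
      using decseqD[OF anti that] by simp
    then show "ereal (f k - fs) < \<eta>0" using K(1) by (rule le_less_trans)
  qed
  have main: "2 * t (Suc k) + C * \<psi> (Suc k) \<le> t k + C * \<psi> k" if k: "k \<ge> K" and "X k \<in> U" for k
  proof -
    let ?D = "\<phi>' (f k - fs)"
    have D: "(\<phi> has_real_derivative ?D) (at (f k - fs))" "0 < ?D"
      using deriv gap[OF k] by auto
    have "F xb < F (X k)"
      using gap[OF k] Fxb FX[of k] by simp
    moreover have "F (X k) < F xb + \<eta>0"
      using gap(2)[OF k] Fxb FX[of k] by (cases \<eta>0) simp_all
    ultimately have "1 \<le> ereal (\<phi>' (real_of_ereal (F (X k) - F xb)))
        * dist_to_set 0 (limiting_subdiff F (X k))"
      using ineq \<open>X k \<in> U\<close> by blast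
    then have "1 \<le> ereal ?D * dist_to_set 0 (limiting_subdiff F (X k))"
      by (simp add: Fxb FX)
    also have "\<dots> \<le> ereal ?D * ereal (norm (w k))"
    proof (rule ereal_mult_left_mono)
      show "dist_to_set 0 (limiting_subdiff F (X k)) \<le> ereal (norm (w k))"
        unfolding dist_to_set_def using sub(1)[of k] by (rule INF_lower2) simp
    qed (use D in simp)
    finally have "1 \<le> ?D * norm (w k)"
      by simp
    also have "\<dots> \<le> ?D * (b * t k)"
      using sub(2) D by (intro mult_left_mono) auto
    finally have one: "1 \<le> ?D * (b * t k)" .
    \<comment> \<open>By concavity, the drop of \<open>\<phi>\<close> is at least its slope at the
      larger gap times the decrease of the objective.\<close>
    have "?D * (m * (t (Suc k))\<^sup>2) \<le> ?D * ((f k - fs) - (f (Suc k) - fs))"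
      using dec[of k] D by (intro mult_left_mono) auto
    also have "\<dots> \<le> \<psi> k - \<psi> (Suc k)"
      unfolding \<psi>_def
      using concave_on_gradient_inequality[OF conc D(1) gap[OF k] less_imp_le[OF gap(1)] gap(2)] k
      by simp
    finally have \<Delta>: "?D * (m * (t (Suc k))\<^sup>2) \<le> \<psi> k - \<psi> (Suc k)" .
    \<comment> \<open>Multiplying by \<open>one\<close> brings in the unknown slope
      \<open>?D\<close>, which \<open>\<Delta>\<close> then absorbs; the result no longer mentions
      it.\<close>
    have "m * (t (Suc k))\<^sup>2 \<le> (?D * (b * t k)) * (m * (t (Suc k))\<^sup>2)"
      using mult_right_mono[OF one, of "m * (t (Suc k))\<^sup>2"] mb by simp
    also have "\<dots> = (b * t k) * (?D * (m * (t (Suc k))\<^sup>2))"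
      by simp
    also have "\<dots> \<le> (b * t k) * (\<psi> k - \<psi> (Suc k))"
      using \<Delta> mb t0 by (intro mult_left_mono) auto
    finally have sq: "(t (Suc k))\<^sup>2 \<le> t k * (C * (\<psi> k - \<psi> (Suc k)))"
      using mb by (simp add: C_def field_simps)
    \<comment> \<open>The sign of the drop of \<open>\<psi>\<close> is what allows square roots to
      be taken at the end.\<close>
    have "0 \<le> ?D * (m * (t (Suc k))\<^sup>2)"
      using D mb by simp
    then have "0 \<le> C * (\<psi> k - \<psi> (Suc k))"
      using \<Delta> C by (intro mult_nonneg_nonneg) auto
    \<comment> \<open>AM-GM\<close>
    moreover have "(2 * t (Suc k))\<^sup>2 \<le> (t k + C * (\<psi> k - \<psi> (Suc k)))\<^sup>2"
      using sq zero_le_power2[of "t k - C * (\<psi> k - \<psi> (Suc k))"]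
      by (simp add: power2_sum power2_diff power_mult_distrib)
    ultimately have "2 * t (Suc k) \<le> t k + C * (\<psi> k - \<psi> (Suc k))"
      by (intro power2_le_imp_le[OF _ add_nonneg_nonneg[OF t0]])
    then show ?thesis
      by (simp add: algebra_simps)
  qed
  have \<psi>0: "0 \<le> \<psi> k" if "k \<ge> K" for k
    using nonneg gap[OF that] unfolding \<psi>_def by auto
  define S where "S n = (\<Sum>i<n. t (Suc (K + i)))" for n
  \<comment> \<open>The path length \<open>S n\<close> is then below half of \<open>\<rho>\<close>,
    since the other summands of the potential are nonnegative.\<close>
  have near: "X (K + n) \<in> U" if "S n + t (K + n) + C * \<psi> (K + n) \<le> t K + C * \<psi> K" for n
  proof -
    have "norm (X (K + n) - X K) \<le> S n" for n
    proof (induction n)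
      case (Suc n)
      have "norm (X (K + Suc n) - X K) \<le> norm (X (Suc (K + n)) - X (K + n)) + norm (X (K + n) - X K)"
        using norm_triangle_ineq[of "X (Suc (K + n)) - X (K + n)" "X (K + n) - X K"] by simp
      also have "\<dots> \<le> S (Suc n)"
        using step[of "K + n"] Suc.IH by (simp add: S_def)
      finally show ?case .
    qed (simp add: S_def)
    moreover have "S n \<le> t K + C * \<psi> K"
      using that t0[of "K + n"] mult_nonneg_nonneg[OF less_imp_le[OF C] \<psi>0[of "K + n"]] by simp
    ultimately have "dist (X (K + n)) (X K) < \<rho> / 2"
      using K(2) unfolding dist_norm by (meson le_less_trans order_trans)
    then have "dist (X (K + n)) xb < \<rho>"
      using K(3) dist_triangle[of "X (K + n)" xb "X K"] by simp
    then show ?thesis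
      using \<rho> by (auto simp: dist_commute)
  qed
  \<comment> \<open>The bound at \<open>n\<close> keeps \<open>X (K + n)\<close> in
    \<open>U\<close>, so \<open>main\<close> applies there and gives the bound at
    \<open>Suc n\<close>. Of the two copies of \<open>t (Suc (K + n))\<close>, one extends
    \<open>S\<close> and the other replaces \<open>t (K + n)\<close>.\<close>
  have pot: "S n + t (K + n) + C * \<psi> (K + n) \<le> t K + C * \<psi> K" for n
  proof (induction n)
    case (Suc n)
    have "2 * t (Suc (K + n)) + C * \<psi> (Suc (K + n)) \<le> t (K + n) + C * \<psi> (K + n)"
      using main near[OF Suc.IH] by simp
    then show ?case
      using Suc.IH by (simp add: S_def)
  qed (simp add: S_def)
  have "summable (\<lambda>i. t (Suc (K + i)))"
  proof (rule summableI_nonneg_bounded)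
    fix n
    show "(\<Sum>i<n. t (Suc (K + i))) \<le> t K + C * \<psi> K"
      using pot[of n] t0[of "K + n"] mult_nonneg_nonneg[OF less_imp_le[OF C] \<psi>0[of "K + n"]]
      unfolding S_def by simp
  qed (rule t0)
  moreover have "(\<lambda>i. t (Suc (K + i))) = (\<lambda>i. t (i + Suc K))"
    by (rule ext) (simp only: add_Suc_right add.commute)
  ultimately show ?thesis
    using summable_iff_shift[of t "Suc K"] by metis
qed

lemma summable_increments_imp_convergent:
  fixes X :: "nat \<Rightarrow> 'a::banach"
  assumes "summable (\<lambda>k. norm (X (Suc k) - X k))"
  shows "convergent X"
proof -
  have "summable (\<lambda>k. X (Suc k) - X k)"
    using assms by (rule summable_norm_cancel)
  then have "(\<lambda>n. \<Sum>k<n. X (Suc k) - X k) \<longlonglongrightarrow> (\<Sum>k. X (Suc k) - X k)"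
    by (rule summable_LIMSEQ)
  then have "(\<lambda>n. X n - X 0 + X 0) \<longlonglongrightarrow> (\<Sum>k. X (Suc k) - X k) + X 0"
    unfolding sum_lessThan_telescope by (rule tendsto_add) simp
  then show ?thesis
    by (auto intro: convergentI)
qed

section \<open>Convergence of the SCN-PG iterates\<close>

theorem theorem3:
  fixes g F :: "real^'n::finite \<Rightarrow> ereal" and h :: "real^'n \<Rightarrow> real"
    and L \<alpha> c \<eta> q \<omega>_low :: real
    and \<omega> \<epsilon> M \<sigma> :: "nat \<Rightarrow> real"
    and x y :: "nat \<Rightarrow> real^'n"
  assumes F_def: "\<And>u. F u = g u + ereal (h u)"
    and g: "proper_fun g" "lsc_fun g"
    and h: "twice_continuously_differentiable h" "L \<ge> 0" "L-lipschitz_on UNIV (gradient h)"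
    and hess: "\<And>u S. S \<subseteq> supp u \<Longrightarrow>
      has_hessian_wrt S F u \<and>
      strictly_continuous_at_rel {z. supp z = supp u} (hessian_wrt S F) u"
    and bounded_below: "(INF u. F u) > -\<infinity>"
    and coercive: "(F \<longlongrightarrow> \<infinity>) at_infinity"
    and KL: "\<And>u. u \<in> dom_subdiff F \<Longrightarrow> KL_property F u"
    and \<alpha>: "0 < \<alpha>" "L > 0 \<Longrightarrow> \<alpha> < 1 / L"
    and params: "c > 0" "\<eta> > 0" "0 < q" "q < 1" "\<omega>_low > 1"
      "\<And>k. k \<ge> 1 \<Longrightarrow> \<omega> k \<ge> \<omega>_low" "\<And>k. k \<ge> 1 \<Longrightarrow> \<epsilon> k > 0"
    and start: "x 0 = y 0"
    and alg: "SCN_PG g h \<alpha> c \<eta> q \<omega> \<epsilon> M \<sigma> x y"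
  shows "summable (\<lambda>k. norm (x (Suc k) - x k))
    \<and> summable (\<lambda>k. norm (x (Suc k) - y k) + norm (x k - y k))
    \<and> (\<Sum>k. norm (x (Suc k) - x k)) \<le> (\<Sum>k. norm (x (Suc k) - y k) + norm (x k - y k))
    \<and> (\<exists>xb. x \<longlonglongrightarrow> xb \<and> y \<longlonglongrightarrow> xb \<and>
             0 \<in> {v + gradient h xb |v. v \<in> limiting_subdiff g xb})"
proof -

  \<comment> \<open>Gaps, constants and finite objective values\<close>
  define G where "G = gradient h"
  \<comment> \<open>Term \<open>k\<close> here is term k + 1 of the series counted from 1.\<close>
  define r s t where "r k = norm (x (Suc k) - y k)" and "s k = norm (x k - y k)"
    and "t k = r k + s k" for k
  define z where "z k = y k - \<alpha> *\<^sub>R G (y k)" for k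
  define w where "w k = (1 / \<alpha>) *\<^sub>R (z k - x (Suc k)) + G (x (Suc k))" for k
  \<comment> \<open>\<open>a\<close> is the decrease rate of the prox step. The extra factor 1/2 in
    \<open>m\<close> pays for bounding the square of \<open>r + s\<close> by twice the sum of
    squares. In \<open>b\<close>, \<open>1 / \<alpha>\<close> comes from the prox residual and
    \<open>L\<close> from the change of gradient.\<close>
  define a where "a = 1 / (2 * \<alpha>) - L / 2"
  define m where "m = min a (\<eta> / 4) / 2"
  define b where "b = 1 / \<alpha> + L"
  have F_eq: "F = (\<lambda>u. g u + ereal (h u))"
    using F_def by (rule ext)
  have deriv: "GDERIV h u :> G u" for u
    unfolding G_def using h(1) by (rule twice_continuously_differentiable_GDERIV)
  have lip: "L-lipschitz_on UNIV G"
    using h(3) by (simp add: G_def)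
  have iter: "x (Suc k) \<in> prox \<alpha> g (y (Suc k - 1) - \<alpha> *\<^sub>R gradient h (y (Suc k - 1))) \<and>
      cubic_newton_step (\<lambda>u. g u + ereal (h u)) c \<eta> q (\<omega> (Suc k)) (\<epsilon> (Suc k)) (M (Suc k))
        (\<sigma> (Suc k)) (x (Suc k)) (y (Suc k))" for k
    using alg[unfolded SCN_PG_def, rule_format, of "Suc k"] by simp
  have prox: "x (Suc k) \<in> prox \<alpha> g (z k)" for k
    using iter[of k] by (simp add: z_def G_def)
  have newton: "cubic_newton_step F c \<eta> q (\<omega> (Suc k)) (\<epsilon> (Suc k)) (M (Suc k)) (\<sigma> (Suc k))
      (x (Suc k)) (y (Suc k))" for k
    using iter[of k] by (simp add: F_eq)
  \<comment> \<open>The values start at \<open>x 1\<close>, the first prox point: \<open>g\<close>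
    may be infinite at \<open>x 0\<close>. Hence \<open>f k\<close> is the objective at
    \<open>x (Suc k)\<close>.\<close>
  define \<gamma> where "\<gamma> k = real_of_ereal (g (x (Suc k)))" for k
  have \<gamma>: "g (x (Suc k)) = ereal (\<gamma> k)" for k
    using prox_finite[OF g(1) prox[of k]] by (auto simp: \<gamma>_def)
  define f where "f k = \<gamma> k + h (x (Suc k))" for k
  have Ff: "F (x (Suc k)) = ereal (f k)" for k
    by (simp add: F_def \<gamma> f_def)
  have a: "a > 0"
  \<comment> \<open>The step size bound is assumed only for positive \<open>L\<close>, because
    \<open>1 / 0 = 0\<close> in HOL.\<close>
  proof (cases "L = 0")
    case False
    then have "L > 0" "\<alpha> < 1 / L" using h(2) \<alpha> by auto
    then have "L < 1 / \<alpha>" using \<alpha>(1) by (simp add: field_simps)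
    then show ?thesis by (simp add: a_def)
  qed (use \<alpha> in \<open>simp add: a_def\<close>)
  have mb: "m > 0" "b > 0"
    using a params(2) \<alpha> h(2) by (simp_all add: m_def b_def add_pos_nonneg)
  have rs0: "0 \<le> r k" "0 \<le> s k" for k
    by (simp_all add: r_def s_def)
  then have t0: "0 \<le> t k" for k
    by (simp add: t_def)

  \<comment> \<open>Sufficient decrease and vanishing gaps\<close>
  have dec: "m * (t (Suc k))\<^sup>2 \<le> f k - f (Suc k)" for k
  proof -
    \<comment> \<open>The value at \<open>y (Suc k)\<close> is the link: the prox step starts from
      there, and the Newton step from \<open>x (Suc k)\<close> ends there. As \<open>y 0\<close> is
      not the result of a Newton step, the decrease involves \<open>t (Suc k)\<close>.\<close>
    have "ereal (f (Suc k) + a * (r (Suc k))\<^sup>2) \<le> F (y (Suc k))"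
      using prox_gradient_decrease[OF prox[of "Suc k", unfolded z_def] \<gamma> _ deriv lip] \<alpha>(1)
      by (simp add: z_def a_def r_def f_def F_def)
    moreover have "F (y (Suc k)) \<le> ereal (f k - \<eta> / 4 * (s (Suc k))\<^sup>2)"
    \<comment> \<open>This case includes an empty index set. If the points differ, a line search has
      accepted \<open>y (Suc k)\<close>; its cubic gain is dropped because c > 0.\<close>
    proof (cases "y (Suc k) = x (Suc k)")
      case True
      then show ?thesis by (simp add: Ff s_def)
    next
      case False
      then have "sufficient_decrease F c \<eta> (x (Suc k)) (y (Suc k))"
        using newton[of k] by (auto simp: cubic_newton_step_def Let_def split: if_splits)
      then have "F (y (Suc k)) \<le> ereal (f k - \<eta> / 4 * (s (Suc k))\<^sup>2 - c / 6 * s (Suc k) ^ 3)"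
        by (simp add: sufficient_decrease_def Ff s_def norm_minus_commute)
      also have "\<dots> \<le> ereal (f k - \<eta> / 4 * (s (Suc k))\<^sup>2)"
        using params(1) rs0 by simp
      finally show ?thesis .
    qed
    ultimately have "f (Suc k) + a * (r (Suc k))\<^sup>2 \<le> f k - \<eta> / 4 * (s (Suc k))\<^sup>2"
      using order_trans ereal_less_eq(3) by blast
    moreover have "m * (t (Suc k))\<^sup>2 \<le> a * (r (Suc k))\<^sup>2 + \<eta> / 4 * (s (Suc k))\<^sup>2"
    proof -
      have "(t (Suc k))\<^sup>2 \<le> 2 * ((r (Suc k))\<^sup>2 + (s (Suc k))\<^sup>2)"
        using sum_squares_bound[of "r (Suc k)" "s (Suc k)"] by (simp add: t_def power2_sum)
      then have "m * (t (Suc k))\<^sup>2 \<le> m * (2 * ((r (Suc k))\<^sup>2 + (s (Suc k))\<^sup>2))"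
        using mb by (intro mult_left_mono) auto
      also have "\<dots> = min a (\<eta> / 4) * (r (Suc k))\<^sup>2 + min a (\<eta> / 4) * (s (Suc k))\<^sup>2"
        by (simp add: m_def algebra_simps)
      also have "\<dots> \<le> a * (r (Suc k))\<^sup>2 + \<eta> / 4 * (s (Suc k))\<^sup>2"
        by (intro add_mono mult_right_mono) auto
      finally show ?thesis .
    qed
    ultimately show ?thesis by simp
  qed
  have anti: "decseq f"
    using dec mb by (intro decseq_SucI) (smt (verit) zero_le_power2 mult_nonneg_nonneg)
  obtain B where B: "ereal B < (INF u. F u)"
    using ereal_dense2[OF bounded_below] by blast
  have "B \<le> f k" for k
  proof -
    have "ereal B < ereal (f k)"
      using less_le_trans[OF B INF_lower[OF UNIV_I, of F "x (Suc k)"]] by (simp only: Ff)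
    then show ?thesis by simp
  qed
  then obtain fs where f_lim: "f \<longlonglongrightarrow> fs"
    using decseq_convergent[OF anti] by blast
  have t_lim: "t \<longlonglongrightarrow> 0"
  proof -
    \<comment> \<open>The decrements of the convergent sequence \<open>f\<close> tend to 0 and
      dominate the squared gaps.\<close>
    have "(\<lambda>k. f k - f (Suc k)) \<longlonglongrightarrow> fs - fs"
      using f_lim by (intro tendsto_diff LIMSEQ_Suc)
    then have "(\<lambda>k. (f k - f (Suc k)) / m) \<longlonglongrightarrow> (fs - fs) / m"
      using mb by (intro tendsto_divide tendsto_const) auto
    then have lim: "(\<lambda>k. (f k - f (Suc k)) / m) \<longlonglongrightarrow> 0"
      by simp
    have "(t (Suc k))\<^sup>2 \<le> (f k - f (Suc k)) / m" for k
      using dec[of k] mb by (simp add: pos_le_divide_eq mult.commute)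
    then have "(\<lambda>k. (t (Suc k))\<^sup>2) \<longlonglongrightarrow> 0"
      by (intro tendsto_sandwich[OF _ _ tendsto_const lim]) auto
    then have "(\<lambda>k. sqrt ((t (Suc k))\<^sup>2)) \<longlonglongrightarrow> sqrt 0"
      by (rule tendsto_real_sqrt)
    then show ?thesis
      using t0 by (simp add: filterlim_sequentially_Suc)
  qed
  have r_lim: "r \<longlonglongrightarrow> 0"
    by (rule tendsto_sandwich[OF _ _ tendsto_const t_lim]; use rs0 in \<open>simp add: t_def\<close>)
  have xy_lim: "(\<lambda>k. y k - x (Suc k)) \<longlonglongrightarrow> 0"
    using r_lim unfolding r_def by (subst tendsto_norm_zero_iff[symmetric]) (simp add: norm_minus_commute)
  have step: "norm (x (Suc k) - x k) \<le> t k" for k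
    using norm_triangle_ineq[of "x (Suc k) - y k" "y k - x k"]
    by (simp add: t_def r_def s_def norm_minus_commute)

  \<comment> \<open>Subgradients bounded by the gaps\<close>
  have w_frechet: "w k \<in> frechet_subdiff F (x (Suc k))" for k
    unfolding w_def F_eq using prox_in_frechet_subdiff_add[OF prox \<gamma> deriv lip] .
  have w: "w k \<in> limiting_subdiff F (x (Suc k))" for k
    using w_frechet frechet_subdiff_subset_limiting by blast
  have w_norm: "norm (w k) \<le> b * t k" for k
  proof -
    \<comment> \<open>Unfolding \<open>z k\<close> produces \<open>- G (y k)\<close>, which pairs
      with \<open>G (x (Suc k))\<close> to a difference that the Lipschitz bound controls.\<close>
    have "w k = (1 / \<alpha>) *\<^sub>R (y k - x (Suc k)) + (G (x (Suc k)) - G (y k))"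
      using \<alpha>(1) by (simp add: w_def z_def algebra_simps)
    then have "norm (w k) \<le> 1 / \<alpha> * r k + norm (G (x (Suc k)) - G (y k))"
      using norm_triangle_ineq[of "(1 / \<alpha>) *\<^sub>R (y k - x (Suc k))" "G (x (Suc k)) - G (y k)"] \<alpha>(1)
      by (simp add: r_def norm_minus_commute)
    also have "\<dots> \<le> 1 / \<alpha> * r k + L * r k"
      using lipschitz_onD[OF lip, of "x (Suc k)" "y k"] by (simp add: dist_norm r_def)
    also have "\<dots> = b * r k"
      by (simp add: b_def algebra_simps)
    also have "\<dots> \<le> b * t k"
      using mb rs0 by (intro mult_left_mono) (auto simp: t_def)
    finally show ?thesis .
  qed

  \<comment> \<open>A cluster point and its objective value\<close>
  obtain \<rho> xb where \<rho>: "strict_mono \<rho>" and x_sub: "(\<lambda>j. x (Suc (\<rho> j))) \<longlonglongrightarrow> xb"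
  proof -
    \<comment> \<open>Outside some ball \<open>F\<close> exceeds \<open>f 0\<close>, whereas the
      decreasing \<open>f\<close> never does, so the iterates stay in a compact ball.\<close>
    have "\<forall>\<^sub>F u in at_infinity. ereal (f 0) < F u"
      using coercive by (simp add: tendsto_PInfty)
    then obtain R where R: "\<And>u. R \<le> norm u \<Longrightarrow> ereal (f 0) < F u"
      by (auto simp: eventually_at_infinity)
    have "norm (x (Suc k)) \<le> R" for k
    proof (rule ccontr)
      assume "\<not> norm (x (Suc k)) \<le> R"
      then have "ereal (f 0) < ereal (f k)"
        using R[of "x (Suc k)"] Ff by simp
      then show False
        using decseqD[OF anti, of 0 k] by simp
    qed
    then have "\<forall>k. x (Suc k) \<in> cball 0 R"
      by simp
    then obtain xb \<rho> where "strict_mono \<rho>" "((\<lambda>k. x (Suc k)) \<circ> \<rho>) \<longlonglongrightarrow> xb"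
      using compact_cball[of 0 R] unfolding compact_def by meson
    then show ?thesis
      using that by (simp add: o_def)
  qed
  have G_cont: "continuous_on UNIV G"
    using lip by (rule lipschitz_on_continuous_on)
  have h_cont: "continuous_on UNIV h"
    using deriv has_derivative_continuous unfolding gderiv_def
    by (metis continuous_at_imp_continuous_on)
  have h_sub: "(\<lambda>j. h (x (Suc (\<rho> j)))) \<longlonglongrightarrow> h xb"
    using continuous_on_tendsto_compose[OF h_cont x_sub] by simp
  have y_sub: "(\<lambda>j. y (\<rho> j)) \<longlonglongrightarrow> xb"
    using tendsto_add[OF LIMSEQ_subseq_LIMSEQ[OF xy_lim \<rho>] x_sub] by (simp add: o_def)
  have z_sub: "(\<lambda>j. z (\<rho> j)) \<longlonglongrightarrow> xb - \<alpha> *\<^sub>R G xb"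
    unfolding z_def using continuous_on_tendsto_compose[OF G_cont y_sub]
    by (intro tendsto_intros y_sub) auto
  have f_sub: "(\<lambda>j. f (\<rho> j)) \<longlonglongrightarrow> fs"
    using LIMSEQ_subseq_LIMSEQ[OF f_lim \<rho>] by (simp add: o_def)
  have \<gamma>_sub: "(\<lambda>j. \<gamma> (\<rho> j)) \<longlonglongrightarrow> fs - h xb"
    using tendsto_diff[OF f_sub h_sub] by (simp add: f_def)
  \<comment> \<open>Lower semicontinuity gives \<open>\<le>\<close>, minimality of the prox points gives \<open>\<ge>\<close>.\<close>
  have g_xb: "g xb = ereal (fs - h xb)"
  proof (rule antisym)
    show "g xb \<le> ereal (fs - h xb)"
    proof (rule ccontr)
      assume "\<not> ?thesis"
      then obtain d where d: "fs - h xb < d" "ereal d < g xb"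
        using ereal_dense2[of "ereal (fs - h xb)" "g xb"] by (auto simp: not_le)
      have "\<forall>\<^sub>F j in sequentially. ereal d < g (x (Suc (\<rho> j)))"
        using lsc_fun_eventually_less[OF g(2) x_sub d(2)] .
      then have "\<forall>\<^sub>F j in sequentially. d \<le> \<gamma> (\<rho> j)"
        by eventually_elim (simp add: \<gamma>)
      then have "d \<le> fs - h xb"
        using tendsto_lowerbound[OF \<gamma>_sub] by simp
      with d(1) show False by simp
    qed
    have "(\<lambda>j. \<gamma> (\<rho> j) + 1 / (2 * \<alpha>) * ((norm (x (Suc (\<rho> j)) - z (\<rho> j)))\<^sup>2 - (norm (xb - z (\<rho> j)))\<^sup>2))
        \<longlonglongrightarrow> fs - h xb + 1 / (2 * \<alpha>) * ((norm (xb - (xb - \<alpha> *\<^sub>R G xb)))\<^sup>2 - (norm (xb - (xb - \<alpha> *\<^sub>R G xb)))\<^sup>2)"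
      by (intro tendsto_intros \<gamma>_sub x_sub z_sub)
    then have "(\<lambda>j. ereal (\<gamma> (\<rho> j)
        + 1 / (2 * \<alpha>) * ((norm (x (Suc (\<rho> j)) - z (\<rho> j)))\<^sup>2 - (norm (xb - z (\<rho> j)))\<^sup>2)))
        \<longlonglongrightarrow> ereal (fs - h xb)"
      by simp
    then show "ereal (fs - h xb) \<le> g xb"
      by (rule LIMSEQ_le_const2) (use prox_minorant[OF prox \<gamma>] in blast)
  qed
  then have F_xb: "F xb = ereal fs"
    by (simp add: F_def)

  \<comment> \<open>Finite length, convergence and stationarity\<close>
  have "w \<longlonglongrightarrow> 0"
    by (rule Lim_null_comparison[where g = "\<lambda>k. b * t k"])
      (use w_norm tendsto_mult_left[OF t_lim, of b] in auto)
  then have w_sub: "(\<lambda>j. w (\<rho> j)) \<longlonglongrightarrow> 0"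
    using LIMSEQ_subseq_LIMSEQ[OF _ \<rho>] by (simp add: o_def)
  \<comment> \<open>This places \<open>xb\<close> in the domain of the subdifferential, where the KL
    property is assumed. The convergence of \<open>F\<close> to its value at \<open>xb\<close>
    enters here.\<close>
  have "0 \<in> limiting_subdiff F xb"
    by (rule limiting_subdiffI[OF _ x_sub _ w_frechet w_sub])
      (use f_sub in \<open>simp_all add: F_xb Ff\<close>)
  then have "KL_property F xb"
    using KL by (auto simp: dom_subdiff_def)
  then have sum_t: "summable t"
    by (rule KL_finite_length[where X = "\<lambda>k. x (Suc k)",
          OF _ F_xb Ff f_lim mb t0 t_lim dec step w w_norm \<rho>])
      (use x_sub in \<open>simp add: o_def\<close>)
  then have sum_x: "summable (\<lambda>k. norm (x (Suc k) - x k))"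
    by (rule summable_comparison_test'[where N = 0]) (use step in simp)
  \<comment> \<open>Finite length gives some limit, and the subsequence identifies it with
    \<open>xb\<close>.\<close>
  have x_lim: "x \<longlonglongrightarrow> xb"
  proof -
    obtain l where l: "x \<longlonglongrightarrow> l"
      using summable_increments_imp_convergent[OF sum_x] by (auto simp: convergent_def)
    then have "(\<lambda>j. x (Suc (\<rho> j))) \<longlonglongrightarrow> l"
      using LIMSEQ_subseq_LIMSEQ[OF LIMSEQ_Suc \<rho>] by (simp add: o_def)
    with x_sub l show ?thesis
      using LIMSEQ_unique by blast
  qed
  have y_lim: "y \<longlonglongrightarrow> xb"
    using tendsto_add[OF xy_lim LIMSEQ_Suc[OF x_lim]] by simp
  \<comment> \<open>Stationarity concerns \<open>g\<close> alone, so the prox residuals themselves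
    are used as subgradients of \<open>g\<close>. As \<open>z\<close> tends to
    \<open>xb - \<alpha> *\<^sub>R G xb\<close> along \<open>\<rho>\<close>, they tend to
    \<open>- G xb\<close>.\<close>
  have "- G xb \<in> limiting_subdiff g xb"
  proof -
    have "(\<lambda>j. (1 / \<alpha>) *\<^sub>R (z (\<rho> j) - x (Suc (\<rho> j)))) \<longlonglongrightarrow> (1 / \<alpha>) *\<^sub>R (xb - \<alpha> *\<^sub>R G xb - xb)"
      by (intro tendsto_intros z_sub x_sub)
    then have v: "(\<lambda>j. (1 / \<alpha>) *\<^sub>R (z (\<rho> j) - x (Suc (\<rho> j)))) \<longlonglongrightarrow> - G xb"
      using \<alpha>(1) by simp
    show ?thesis
      by (rule limiting_subdiffI[OF _ x_sub _ prox_in_frechet_subdiff[OF prox \<gamma>] v])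
        (use \<gamma>_sub in \<open>simp_all add: \<gamma> g_xb\<close>)
  qed
  then have "0 \<in> {v + gradient h xb |v. v \<in> limiting_subdiff g xb}"
    by (force simp: G_def)
  moreover have "(\<Sum>k. norm (x (Suc k) - x k)) \<le> (\<Sum>k. t k)"
    using step sum_x sum_t by (intro suminf_le) auto
  ultimately show ?thesis
    using sum_x sum_t x_lim y_lim unfolding t_def r_def s_def by blast
qed

end
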